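(* Let $n\ge2$, $0<s<1$, $0<p,q<\infty$ and $u^*\in W^{s,p}_q(\mathbb{R}^n)$. Then there exists a set $E\subset\mathbb{R}^n$ which is $(p,s)$-thin at infinity such that $u^*(x)\to0$ when $|x|\to\infty$ in $\mathbb{R}^n\setminus E$, i.e. for every $\varepsilon>0$ there is $R>0$ with $|u^*(x)|<\varepsilon$ for all $x\in\mathbb{R}^n\setminus E$ with $|x|>R$.
   Context: For a measurable $u:\mathbb{R}^n\to\mathbb{R}$, set $[u]_{W^{s,p}_q(\mathbb{R}^n)}=\Big(\int_{\mathbb{R}^n}\Big(\int_{\mathbb{R}^n}\frac{|u(x)-u(y)|^q}{|x-y|^{n+sq}}\,dy\Big)^{p/q}dx\Big)^{1/p}$. A cube in $\mathbb{R}^n$ is a set $Q=[a_1,b_1)\times\cdots\times[a_n,b_n)$ with $b_1-a_1=\cdots=b_n-a_n>0$. For measurable a.e. finite $u$ and a measurable set $E$ of finite positive measure, the median is $m_u(E)=\sup\{M\in\mathbb{R}: |\{x\in E: u(x)<M\}|\le |E|/2\}$, where $|\cdot|$ is Lebesgue measure. The precise representative of $u$ is $u^*(x)=\limsup_{|Q|\to0,\ x\in Q}m_u(Q)=\inf_{\delta>0}\sup\{m_u(Q): Q \text{ a cube},\ x\in Q,\ |Q|<\delta\}$ (an extended real value), for every $x\in\mathbb{R}^n$; one has $u^*=u$ a.e. The space $\dot{W}^{s,p}_q(\mathbb{R}^n)$ is the collection of all precise representatives $u^*$ of measurable functions $u:\mathbb{R}^n\to\mathbb{R}$ with $[u]_{W^{s,p}_q(\mathbb{R}^n)}<\infty$,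 and $W^{s,p}_q(\mathbb{R}^n)=\dot{W}^{s,p}_q(\mathbb{R}^n)\cap L^p(\mathbb{R}^n)$. For $\lambda\in(0,\infty)$ the Hausdorff content is $\mathcal{H}^\lambda_\infty(A)=\inf\{\sum_{j}\operatorname{diam}(B_j)^\lambda: A\subset\bigcup_j B_j\}$ over countable covers. A set $E\subset\mathbb{R}^n$ is $(p,s)$-thin at infinity if $\lim_{m\to\infty}\mathcal{H}^\lambda_\infty(E\cap B(0,m)^c)=0$ for every $\lambda\in(0,\infty)$ with $\lambda>n-sp$. *)

theory Defs
  imports "HOL-Analysis.Analysis"
begin

definition ennreal_powr :: "ennreal \<Rightarrow> real \<Rightarrow> ennreal" where
  \<comment> \<open>used only for exponents \<open>a > 0\<close>; then \<open>0\<close> is sent to \<open>0\<close> and \<open>\<infinity>\<close> to \<open>\<infinity>\<close>\<close>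
  "ennreal_powr x a = (if x = \<infinity> then \<infinity> else ennreal (enn2real x powr a))"

definition sobolev_seminorm ::
  "real \<Rightarrow> real \<Rightarrow> real \<Rightarrow> (real ^ 'n \<Rightarrow> real) \<Rightarrow> ennreal" where
  \<comment> \<open>on the diagonal the quotient has the value \<open>0\<close>; this concerns only the null set \<open>{x}\<close>\<close>
  "sobolev_seminorm s p q u =
     ennreal_powr
       (\<integral>\<^sup>+ x. ennreal_powr
          (\<integral>\<^sup>+ y. ennreal (\<bar>u x - u y\<bar> powr q / norm (x - y) powr (real CARD('n) + s * q)) \<partial>lebesgue)
          (p / q) \<partial>lebesgue)
       (1 / p)"

definition cube :: "(real ^ 'n) set \<Rightarrow> bool" where
  "cube Q \<longleftrightarrow>
     (\<exists>a b. (\<forall>i. a $ i < b $ i) \<and> (\<forall>i j. b $ i - a $ i = b $ j - a $ j) \<and>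
            Q = {x. \<forall>i. a $ i \<le> x $ i \<and> x $ i < b $ i})"

text \<open>The median is meant for sets of finite positive measure. There it is a real number, and
  taking the supremum in the extended reals does not change it.\<close>

definition median :: "(real ^ 'n \<Rightarrow> real) \<Rightarrow> (real ^ 'n) set \<Rightarrow> ereal" where
  "median u E =
     Sup (ereal ` {M. emeasure lebesgue {x \<in> E. u x < M} \<le> emeasure lebesgue E / 2})"

definition precise_rep :: "(real ^ 'n \<Rightarrow> real) \<Rightarrow> real ^ 'n \<Rightarrow> ereal" where
  "precise_rep u x =
     (INF \<delta>\<in>{0::real<..}. SUP Q\<in>{Q. cube Q \<and> x \<in> Q \<and> emeasure lebesgue Q < ennreal \<delta>}. median u Q)"

definition homogeneous_sobolev ::
  "real \<Rightarrow> real \<Rightarrow> real \<Rightarrow> (real ^ 'n \<Rightarrow> ereal) set" where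
  "homogeneous_sobolev s p q =
     {precise_rep u | u. u \<in> borel_measurable lebesgue \<and> sobolev_seminorm s p q u < \<infinity>}"

definition Lp_functions :: "real \<Rightarrow> (real ^ 'n \<Rightarrow> ereal) set" where
  "Lp_functions p =
     {f. f \<in> borel_measurable lebesgue \<and>
         (\<integral>\<^sup>+ x. ennreal_powr (e2ennreal \<bar>f x\<bar>) p \<partial>lebesgue) < \<infinity>}"

definition sobolev :: "real \<Rightarrow> real \<Rightarrow> real \<Rightarrow> (real ^ 'n \<Rightarrow> ereal) set" where
  "sobolev s p q = homogeneous_sobolev s p q \<inter> Lp_functions p"

text \<open>The library's \<open>diameter\<close> is \<open>0\<close> on unbounded sets, so it cannot be used for arbitrary
  covering sets.\<close>

definition ediameter :: "'a::metric_space set \<Rightarrow> ennreal" where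
  "ediameter B = (SUP x\<in>B. SUP y\<in>B. ennreal (dist x y))"

text \<open>Finite covers are included: pad them with the empty set, whose diameter is \<open>0\<close>.\<close>

definition hausdorff_content :: "real \<Rightarrow> 'a::metric_space set \<Rightarrow> ennreal" where
  "hausdorff_content l A =
     (INF B\<in>{B :: nat \<Rightarrow> 'a set. A \<subseteq> (\<Union>j. B j)}. \<Sum>j. ennreal_powr (ediameter (B j)) l)"

definition thin_at_infinity :: "real \<Rightarrow> real \<Rightarrow> (real ^ 'n) set \<Rightarrow> bool" where
  "thin_at_infinity p s E \<longleftrightarrow>
     (\<forall>l>0. l > real CARD('n) - s * p \<longrightarrow>
        (\<lambda>m::nat. hausdorff_content l (E \<inter> - ball 0 (real m))) \<longlonglongrightarrow> 0)"

end

theory Submission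
  imports Defs
begin

text \<open>Write \<open>u\<^sup>*\<close> for the precise representative, \<open>n\<close> for the dimension, \<open>G\<close> for the inner integral of the seminorm
  (\<open>fractional_energy\<close>) and \<open>g = G powr (p / q)\<close>, so that the seminorm is finite precisely when \<open>g\<close> is
  integrable. The heart of the matter is that for fixed \<open>\<epsilon> > 0\<close> and \<open>L > 0\<close> with \<open>L > n - s p\<close> the content
  \<open>\<H>\<^sup>L\<close> of the part of \<open>{\<bar>u\<^sup>*\<bar> \<ge> \<epsilon>}\<close> outside a large ball tends to \<open>0\<close>
  (\<open>level_set_content_tendsto_0\<close>).

  This is a stopping time argument (\<open>stopping_ball_energy\<close>). Choose \<open>d > 0\<close> with
  \<open>L = n + (d - s) p\<close> and let the threshold \<open>t r\<close> increase from \<open>\<epsilon> / 4\<close> towards \<open>\<epsilon> / 2\<close> as \<open>r\<close> decreases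
  from \<open>1\<close> to \<open>0\<close>, with increments \<open>t r - t (2 r)\<close> proportional to \<open>r powr d\<close>. If
  \<open>\<bar>u\<^sup>* x\<bar> \<ge> \<epsilon>\<close>, then some small ball around \<open>x\<close> has a fixed fraction of its points in \<open>{\<bar>u\<bar> > t r}\<close>. At unit
  scale this fails for \<open>x\<close> far out, because \<open>u\<close> is \<open>p\<close>-integrable. At the first dyadic radius where it holds,
  a fixed fraction of the ball of radius \<open>r\<close> lies above \<open>t r\<close> while a fixed fraction of the ball of radius
  \<open>2 r\<close> lies below \<open>t (2 r)\<close>. The jump makes \<open>G\<close> at least of order \<open>r powr ((d - s) q)\<close> on the former set, so
  that \<open>g\<close> has integral at least of order \<open>r powr L\<close> over the ball of radius \<open>r\<close>. By Vitali's covering lemma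
  (\<open>hausdorff_content_le_measure\<close>) the content of the level set outside a large ball is at most a multiple of the integral
  of \<open>g\<close> near infinity.

  The \<open>p\<close>-integrability is given for \<open>u\<^sup>*\<close>, but needed for \<open>u\<close>. The two agree almost everywhere, and the seminorm
  itself shows this without a density theorem: finiteness of \<open>G x\<close> forces \<open>u\<close> to have the approximate limit \<open>u x\<close>
  at \<open>x\<close> (\<open>precise_rep_eq_if_fractional_energy_finite\<close>).

  Finally the exceptional sets for the levels \<open>1 / (k + 1)\<close> are glued together, each restricted to the complement of its own large
  ball, to a single set that works for all exponents at once (\<open>diagonal_thin_set\<close>).\<close>

section \<open>Powers of extended nonnegative reals\<close>

lemma ennreal_powr_0 [simp]: "ennreal_powr 0 a = 0"
  by (simp add: ennreal_powr_def)

lemma ennreal_powr_ennreal: "0 \<le> r \<Longrightarrow> ennreal_powr (ennreal r) a = ennreal (r powr a)"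
  by (simp add: ennreal_powr_def)

lemma ennreal_powr_less_top_iff: "ennreal_powr x a < \<infinity> \<longleftrightarrow> x < \<infinity>"
  by (simp add: ennreal_powr_def less_top[symmetric])

lemma ennreal_powr_mono:
  assumes "x \<le> y" "0 \<le> a"
  shows "ennreal_powr x a \<le> ennreal_powr y a"
proof (cases "y = \<infinity>")
  case False
  then have "x \<noteq> \<infinity>" "enn2real x \<le> enn2real y"
    using assms by (auto simp: top_unique intro: enn2real_mono simp: less_top)
  then show ?thesis
    using False assms by (auto simp: ennreal_powr_def intro!: ennreal_leI powr_mono2)
qed (simp add: ennreal_powr_def)

lemma ennreal_powr_antimono_exponent:
  assumes "x \<le> 1" "a \<le> b"
  shows "ennreal_powr x b \<le> ennreal_powr x a"
proof (cases "x = 0")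
  case False
  have "x \<noteq> \<infinity>" using assms(1) by (auto simp: top_unique)
  moreover have "enn2real x \<le> 1" 
    using assms(1) enn2real_mono[of x 1] by simp
  ultimately show ?thesis
    using False assms by (auto simp: ennreal_powr_def intro!: ennreal_leI powr_mono')
qed simp

section \<open>Hausdorff content\<close>

lemma hausdorff_content_mono: "A \<subseteq> B \<Longrightarrow> hausdorff_content l A \<le> hausdorff_content l B"
  unfolding hausdorff_content_def by (intro INF_superset_mono) auto

lemma hausdorff_content_le_cover:
  assumes "A \<subseteq> (\<Union>j::nat. B j)"
  shows "hausdorff_content l A \<le> (\<Sum>j. ennreal_powr (ediameter (B j)) l)"
  unfolding hausdorff_content_def using assms by (intro INF_lower) auto

lemma hausdorff_content_less_obtain:
  assumes "hausdorff_content l A < c"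
  obtains B :: "nat \<Rightarrow> _" where "A \<subseteq> (\<Union>j. B j)" "(\<Sum>j. ennreal_powr (ediameter (B j)) l) < c"
  using assms unfolding hausdorff_content_def INF_less_iff by blast

text \<open>A cover whose sum is below \<open>1\<close> consists of sets of diameter at most \<open>1\<close>, for which a larger exponent makes every
  summand smaller. This lets one sequence of exponents decreasing to the critical one control all exponents.\<close>

lemma hausdorff_content_antimono_exponent:
  assumes A: "hausdorff_content l A < 1" and l: "0 < l" "l \<le> l'"
  shows "hausdorff_content l' A \<le> hausdorff_content l A"
proof (rule ccontr)
  assume "\<not> ?thesis"
  then have "hausdorff_content l A < min 1 (hausdorff_content l' A)"
    using A by simp
  then obtain B :: "nat \<Rightarrow> _" where B: "A \<subseteq> (\<Union>j. B j)"
    and sum: "(\<Sum>j. ennreal_powr (ediameter (B j)) l) < min 1 (hausdorff_content l' A)"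
    by (rule hausdorff_content_less_obtain)
  have "ediameter (B j) \<le> 1" for j
  proof (rule ccontr)
    assume "\<not> ediameter (B j) \<le> 1"
    then have "ennreal_powr 1 l \<le> ennreal_powr (ediameter (B j)) l"
      using l by (intro ennreal_powr_mono) auto
    moreover have "ennreal_powr (ediameter (B j)) l \<le> (\<Sum>j. ennreal_powr (ediameter (B j)) l)"
      using sum_le_suminf[of "\<lambda>j. ennreal_powr (ediameter (B j)) l" "{j}"] by simp
    moreover have "ennreal_powr 1 l = 1"
      by (simp add: ennreal_powr_def)
    ultimately have "1 \<le> (\<Sum>j. ennreal_powr (ediameter (B j)) l)"
      by (metis order_trans)
    then show False
      using sum by (simp add: leD)
  qed
  then have "(\<Sum>j. ennreal_powr (ediameter (B j)) l') \<le> (\<Sum>j. ennreal_powr (ediameter (B j)) l)"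
    using l by (intro suminf_le ennreal_powr_antimono_exponent) auto
  then have "hausdorff_content l' A \<le> (\<Sum>j. ennreal_powr (ediameter (B j)) l)"
    using hausdorff_content_le_cover[OF B, of l'] by (rule order_trans[rotated])
  then show False
    using sum by (simp add: leD)
qed

lemma hausdorff_content_countable_subadditive:
  "hausdorff_content l (\<Union>k::nat. A k) \<le> (\<Sum>k. hausdorff_content l (A k))"
proof (rule ennreal_le_epsilon)
  fix e :: real
  assume e: "0 < e" and fin: "(\<Sum>k. hausdorff_content l (A k)) < top"
  have "\<exists>B :: nat \<Rightarrow> _. A k \<subseteq> (\<Union>j. B j) \<and> (\<Sum>j. ennreal_powr (ediameter (B j)) l)
      \<le> hausdorff_content l (A k) + e * (1 / 2) ^ Suc k" for k
  proof -
    have "hausdorff_content l (A k) \<le> (\<Sum>k. hausdorff_content l (A k))"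
      using sum_le_suminf[of "\<lambda>k. hausdorff_content l (A k)" "{k}"] by simp
    then have "hausdorff_content l (A k) < top"
      using fin by (rule le_less_trans)
    moreover have "0 < ennreal (e * (1 / 2) ^ Suc k)"
      using e by simp
    ultimately have "hausdorff_content l (A k) < hausdorff_content l (A k) + e * (1 / 2) ^ Suc k"
      by (simp add: ennreal_add_left_cancel_less[of _ 0, simplified])
    then show ?thesis
      by (metis hausdorff_content_less_obtain less_imp_le)
  qed
  then obtain B :: "nat \<Rightarrow> nat \<Rightarrow> _" where B: "\<And>k. A k \<subseteq> (\<Union>j. B k j)"
    and sum: "\<And>k. (\<Sum>j. ennreal_powr (ediameter (B k j)) l) \<le> hausdorff_content l (A k) + e * (1 / 2) ^ Suc k"
    by metis
  let ?f = "\<lambda>(k, j). ennreal_powr (ediameter (B k j)) l"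
  have cover: "(\<Union>k. A k) \<subseteq> (\<Union>i. case_prod B (prod_decode i))"
  proof
    fix x assume "x \<in> (\<Union>k. A k)"
    then obtain k j where "x \<in> B k j"
      using B by blast
    then have "x \<in> case_prod B (prod_decode (prod_encode (k, j)))"
      by simp
    then show "x \<in> (\<Union>i. case_prod B (prod_decode i))"
      by (rule UN_I[OF UNIV_I])
  qed
  have "hausdorff_content l (\<Union>k. A k) \<le> (\<Sum>i. ?f (prod_decode i))"
    using hausdorff_content_le_cover[OF cover, of l] by (simp add: case_prod_beta)
  also have "\<dots> = (\<Sum>k. \<Sum>j. ?f (k, j))"
    by (rule suminf_ennreal_2dimen) simp
  also have "\<dots> \<le> (\<Sum>k. hausdorff_content l (A k) + e * (1 / 2) ^ Suc k)"
    using sum by (intro suminf_le) auto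
  also have "\<dots> = (\<Sum>k. hausdorff_content l (A k)) + (\<Sum>k. ennreal (e * (1 / 2) ^ Suc k))"
    by (rule suminf_add[symmetric]) auto
  also have "(\<Sum>k. ennreal (e * (1 / 2) ^ Suc k)) = ennreal e"
    using sums_mult[OF power_half_series, of e] e by (intro suminf_ennreal_eq) auto
  finally show "hausdorff_content l (\<Union>k. A k) \<le> (\<Sum>k. hausdorff_content l (A k)) + ennreal e" .
qed

text \<open>The \<open>k\<close>-th set is cut off at a radius beyond which its content is below \<open>2\<^bsup>-k-1\<^esup>\<close>, for an exponent that decreases
  to the critical value as \<open>k\<close> grows. For a given exponent \<open>l\<close> all but finitely many of these exponents lie below
  \<open>l\<close>; the corresponding sets contribute a tail of a geometric series, and each of the finitely many others
  vanishes at infinity by hypothesis.\<close>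

lemma diagonal_thin_set:
  fixes A :: "nat \<Rightarrow> 'a::real_normed_vector set"
  assumes A: "\<And>k l. 0 < l \<Longrightarrow> l0 < l \<Longrightarrow>
      (\<lambda>m::nat. hausdorff_content l (A k \<inter> - ball 0 (real m))) \<longlonglongrightarrow> 0"
  shows "\<exists>E. (\<forall>l>0. l0 < l \<longrightarrow> (\<lambda>m::nat. hausdorff_content l (E \<inter> - ball 0 (real m))) \<longlonglongrightarrow> 0) \<and>
             (\<forall>k. \<exists>m::nat. A k \<inter> - ball 0 (real m) \<subseteq> E)"
proof -
  define lam where "lam k = max 0 l0 + 1 / real (Suc k)" for k
  have lam: "0 < lam k" "l0 < lam k" for k
  proof -
    have "0 < 1 / real (Suc k)" by simp
    then show "0 < lam k" "l0 < lam k"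
      unfolding lam_def by linarith+
  qed
  have "\<exists>m::nat. hausdorff_content (lam k) (A k \<inter> - ball 0 (real m)) < ennreal ((1 / 2) ^ Suc k)" for k
    using order_tendstoD(2)[OF A[OF lam, of k k], of "ennreal ((1 / 2) ^ Suc k)"]
    by (auto simp: eventually_sequentially)
  then obtain M :: "nat \<Rightarrow> nat" where
    M: "\<And>k. hausdorff_content (lam k) (A k \<inter> - ball 0 (real (M k))) < ennreal ((1 / 2) ^ Suc k)"
    by metis
  define E where "E = (\<Union>k. A k \<inter> - ball 0 (real (M k)))"
  have "(\<lambda>m::nat. hausdorff_content l (E \<inter> - ball 0 (real m))) \<longlonglongrightarrow> 0" if l: "0 < l" "l0 < l" for l
  proof (rule order_tendstoI)
    fix e :: ennreal
    assume e: "0 < e"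
    let ?h = "\<lambda>k m. hausdorff_content l (A k \<inter> - ball 0 (real (M k)) \<inter> - ball 0 (real m))"
    have "(\<lambda>K. ennreal ((1 / 2) ^ K)) \<longlonglongrightarrow> 0"
      using tendsto_ennrealI[OF LIMSEQ_power_zero[of "1 / 2 :: real"]] by simp
    then have "\<forall>\<^sub>F K in sequentially. ennreal ((1 / 2) ^ K) < e"
      using e by (rule order_tendstoD)
    moreover have "lam \<longlonglongrightarrow> max 0 l0 + 0"
      unfolding lam_def by (intro tendsto_intros lim_1_over_n[THEN LIMSEQ_Suc])
    then have "\<forall>\<^sub>F K in sequentially. lam K < l"
      using l by (auto intro!: order_tendstoD)
    ultimately have "\<forall>\<^sub>F K in sequentially. ennreal ((1 / 2) ^ K) < e \<and> lam K < l"
      by eventually_elim simp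
    then obtain K where K: "ennreal ((1 / 2) ^ K) < e" "lam K < l"
      by (auto simp: eventually_sequentially)
    have tail: "?h (k + K) m \<le> ennreal ((1 / 2) ^ K * (1 / 2) ^ Suc k)" for k m
    proof -
      have "lam (k + K) \<le> l"
        using K(2) unfolding lam_def by (smt (verit) frac_le of_nat_0_less_iff of_nat_mono zero_less_Suc Suc_le_mono le_add2)
      moreover have "ennreal ((1 / 2) ^ Suc (k + K)) \<le> 1"
        by (simp del: power_Suc add: power_le_one)
      ultimately have "hausdorff_content l (A (k + K) \<inter> - ball 0 (real (M (k + K))))
          \<le> hausdorff_content (lam (k + K)) (A (k + K) \<inter> - ball 0 (real (M (k + K))))"
        using lam[of "k + K"] by (intro hausdorff_content_antimono_exponent less_le_trans[OF M])
      then have "?h (k + K) m \<le> ennreal ((1 / 2) ^ Suc (k + K))"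
        using M[of "k + K"] by (meson hausdorff_content_mono inf_le1 less_imp_le order_trans)
      then show ?thesis
        by (simp add: power_add mult.commute)
    qed
    have half: "(\<Sum>k. ennreal ((1 / 2) ^ K * (1 / 2) ^ Suc k)) = ennreal ((1 / 2) ^ K)"
      using sums_mult[OF power_half_series, of "(1 / 2) ^ K"] by (intro suminf_ennreal_eq) auto
    have bound: "hausdorff_content l (E \<inter> - ball 0 (real m))
        \<le> ennreal ((1 / 2) ^ K) + (\<Sum>k<K. hausdorff_content l (A k \<inter> - ball 0 (real m)))" for m
    proof -
      have eq: "E \<inter> - ball 0 (real m) = (\<Union>k. A k \<inter> - ball 0 (real (M k)) \<inter> - ball 0 (real m))"
        by (auto simp: E_def)
      have "hausdorff_content l (E \<inter> - ball 0 (real m)) \<le> (\<Sum>k. ?h k m)"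
        unfolding eq by (rule hausdorff_content_countable_subadditive)
      also have "\<dots> = (\<Sum>k. ?h (k + K) m) + (\<Sum>k<K. ?h k m)"
        by (rule suminf_offset) simp
      also have "(\<Sum>k. ?h (k + K) m) \<le> ennreal ((1 / 2) ^ K)"
        unfolding half[symmetric] by (intro suminf_le tail) auto
      also have "(\<Sum>k<K. ?h k m) \<le> (\<Sum>k<K. hausdorff_content l (A k \<inter> - ball 0 (real m)))"
        by (intro sum_mono hausdorff_content_mono) auto
      finally show ?thesis
        by (simp add: add_mono)
    qed
    have "(\<lambda>m::nat. ennreal ((1 / 2) ^ K) + (\<Sum>k<K. hausdorff_content l (A k \<inter> - ball 0 (real m))))
        \<longlonglongrightarrow> ennreal ((1 / 2) ^ K) + (\<Sum>k<K. 0)"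
      by (intro tendsto_intros A l)
    then have "\<forall>\<^sub>F m::nat in sequentially.
        ennreal ((1 / 2) ^ K) + (\<Sum>k<K. hausdorff_content l (A k \<inter> - ball 0 (real m))) < e"
      using K(1) by (intro order_tendstoD) auto
    then show "\<forall>\<^sub>F m::nat in sequentially. hausdorff_content l (E \<inter> - ball 0 (real m)) < e"
      by eventually_elim (rule le_less_trans[OF bound])
  qed simp
  moreover have "\<exists>m::nat. A k \<inter> - ball 0 (real m) \<subseteq> E" for k
    unfolding E_def by blast
  ultimately show ?thesis
    by blast
qed

text \<open>Vitali's lemma extracts disjoint balls whose five-fold enlargements, of diameter at most \<open>10 r\<close>, still cover \<open>A\<close>.
  Disjointness allows the lower bounds for the measures of the balls to be summed.\<close>

lemma hausdorff_content_le_measure: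
  fixes A W :: "'a::euclidean_space set"
  assumes borel: "sets borel \<subseteq> sets M" and W: "W \<in> sets M" and "0 < c" "0 < l"
    and ball: "\<And>x. x \<in> A \<Longrightarrow> \<exists>r. 0 < r \<and> r \<le> R \<and> cball x r \<subseteq> W \<and> ennreal (c * r powr l) \<le> emeasure M (cball x r)"
  shows "hausdorff_content l A \<le> ennreal (10 powr l / c) * emeasure M W"
proof -
  obtain r where r: "\<And>x. x \<in> A \<Longrightarrow> 0 < r x \<and> r x \<le> R" "\<And>x. x \<in> A \<Longrightarrow> cball x (r x) \<subseteq> W"
    and rM: "\<And>x. x \<in> A \<Longrightarrow> ennreal (c * r x powr l) \<le> emeasure M (cball x (r x))"
    using ball by metis
  have "A \<subseteq> (\<Union>x\<in>A. cball x (r x))"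
    using r(1) by (force intro: less_imp_le)
  then obtain C where C: "countable C" "C \<subseteq> A"
    and disj: "pairwise (\<lambda>x y. disjnt (cball x (r x)) (cball y (r y))) C"
    and cover: "A \<subseteq> (\<Union>x\<in>C. cball x (5 * r x))"
    by (rule Vitali_covering_lemma_cballs[OF _ r(1)])
  define I where "I = to_nat_on C ` C"
  define f where "f = from_nat_into C"
  have f: "f j \<in> C" if "j \<in> I" for j
    using that C(1) by (auto simp: I_def f_def)
  have f_inj: "f i \<noteq> f j" if "i \<in> I" "j \<in> I" "i \<noteq> j" for i j
    using that C(1) by (auto simp: I_def f_def)
  define B where "B j = (if j \<in> I then cball (f j) (5 * r (f j)) else {})" for j
  define D where "D j = (if j \<in> I then cball (f j) (r (f j)) else {})" for j
  have D_sets: "D j \<in> sets M" for j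
    using borel by (auto simp: D_def)
  have "A \<subseteq> (\<Union>j. B j)"
  proof
    fix y assume "y \<in> A"
    then obtain x where x: "x \<in> C" "y \<in> cball x (5 * r x)"
      using cover by blast
    then have "y \<in> B (to_nat_on C x)"
      using C(1) by (auto simp: B_def I_def f_def)
    then show "y \<in> (\<Union>j. B j)" by blast
  qed
  then have "hausdorff_content l A \<le> (\<Sum>j. ennreal_powr (ediameter (B j)) l)"
    by (rule hausdorff_content_le_cover)
  also have "\<dots> \<le> (\<Sum>j. ennreal (10 powr l / c) * emeasure M (D j))"
  proof (rule suminf_le)
    fix j
    show "ennreal_powr (ediameter (B j)) l \<le> ennreal (10 powr l / c) * emeasure M (D j)"
    proof (cases "j \<in> I")
      case True
      let ?x = "f j"
      have x: "?x \<in> A" using f[OF True] C(2) by blast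
      then have pos: "0 < r ?x" using r(1) by blast
      have "dist y z \<le> 10 * r ?x" if "y \<in> cball ?x (5 * r ?x)" "z \<in> cball ?x (5 * r ?x)" for y z
        using that dist_triangle3[of y z ?x] by simp
      then have "ediameter (B j) \<le> ennreal (10 * r ?x)"
        unfolding ediameter_def B_def using True by (auto intro!: SUP_least ennreal_leI simp del: mem_cball)
      then have "ennreal_powr (ediameter (B j)) l \<le> ennreal_powr (ennreal (10 * r ?x)) l"
        using \<open>0 < l\<close> by (intro ennreal_powr_mono) auto
      also have "\<dots> = ennreal (10 powr l / c * (c * r ?x powr l))"
        using pos \<open>0 < c\<close> by (simp add: ennreal_powr_ennreal powr_mult)
      also have "\<dots> = ennreal (10 powr l / c) * ennreal (c * r ?x powr l)"
        using \<open>0 < c\<close> by (intro ennreal_mult) auto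
      also have "\<dots> \<le> ennreal (10 powr l / c) * emeasure M (D j)"
        using rM[OF x] True by (intro mult_left_mono) (auto simp: D_def)
      finally show ?thesis .
    qed (simp add: B_def ediameter_def bot_ennreal)
  qed auto
  also have "\<dots> = ennreal (10 powr l / c) * (\<Sum>j. emeasure M (D j))"
    by (rule ennreal_suminf_cmult)
  also have "(\<Sum>j. emeasure M (D j)) = emeasure M (\<Union>j. D j)"
  proof (rule suminf_emeasure)
    show "disjoint_family D"
      using f f_inj disj unfolding disjoint_family_on_def D_def pairwise_def disjnt_def by auto
  qed (use D_sets in auto)
  also have "\<dots> \<le> emeasure M W"
    using W f C(2) r(2) by (intro emeasure_mono) (fastforce simp: D_def split: if_splits)+
  finally show ?thesis
    by (simp add: mult_left_mono)
qed

section \<open>Measures of cubes, balls and tails\<close>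

text \<open>The pigeonhole step for two sets, of measures \<open>a\<close> and \<open>b\<close>, that cover a cube or ball of measure at least
  \<open>2 h\<close>. The conclusion is strict because a median tolerates sublevel sets of exactly half of the measure.\<close>

lemma ennreal_less_of_sum_split:
  assumes "ennreal (2 * h) \<le> a + b" "0 \<le> h" "a < ennreal h"
  shows "ennreal h < b"
proof (rule ccontr)
  assume "\<not> ?thesis"
  then have "b \<le> ennreal h" by simp
  with assms show False
    by (cases a; cases b) (auto simp: ennreal_less_iff top_unique simp flip: ennreal_plus)
qed

lemma sets_lebesgue_Collect_in:
  assumes "Q \<in> sets lebesgue" and P: "Measurable.pred lebesgue P"
  shows "{x \<in> Q. P x} \<in> sets lebesgue"
proof -
  have "{x \<in> Q. P x} = Q \<inter> {x \<in> space lebesgue. P x}" by auto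
  also have "\<dots> \<in> sets lebesgue"
    using assms(1) predE[OF P] by (rule sets.Int)
  finally show ?thesis .
qed

lemma sigma_finite_lebesgue: "sigma_finite_measure (lebesgue :: 'a::euclidean_space measure)"
proof
  have "(\<Union>n::nat. ball 0 (real n)) = (UNIV :: 'a set)"
    by (auto simp: reals_Archimedean2)
  moreover have "emeasure lebesgue (ball (0::'a) (real n)) \<noteq> \<infinity>" for n
    using lmeasurable_ball[of "0::'a" "real n"] by (simp add: fmeasurable_def less_top[symmetric])
  ultimately show "\<exists>A::'a set set. countable A \<and> A \<subseteq> sets lebesgue \<and> \<Union> A = space lebesgue \<and>
      (\<forall>a\<in>A. emeasure lebesgue a \<noteq> \<infinity>)"
    by (intro exI[of _ "range (\<lambda>n::nat. ball 0 (real n))"]) auto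
qed

lemma borel_sets_lebesgue: "sets (borel :: 'a::euclidean_space measure) \<subseteq> sets lebesgue"
  by (metis sets_completionI_sets sets_lborel subsetI)

lemma emeasure_half_open_box:
  fixes a b :: "real ^ 'n"
  assumes "0 < l" "\<And>i. b $ i - a $ i = l"
  defines "Q \<equiv> {x. \<forall>i. a $ i \<le> x $ i \<and> x $ i < b $ i}"
  shows "Q \<in> sets lebesgue" "emeasure lebesgue Q = ennreal (l ^ CARD('n))"
proof -
  have le: "a $ i < b $ i" for i
    using assms(1) assms(2)[of i] by linarith
  have "Q = (\<Inter>i. {x. a $ i \<le> x $ i} \<inter> {x. x $ i < b $ i})"
    by (auto simp: Q_def)
  moreover have "{x::real^'n. a $ i \<le> x $ i} \<in> sets borel" "{x::real^'n. x $ i < b $ i} \<in> sets borel" for i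
    by (auto intro!: borel_closed borel_open closed_Collect_le open_Collect_less continuous_intros)
  ultimately have "Q \<in> sets borel"
    by auto
  then show Q: "Q \<in> sets lebesgue"
    by simp
  have ne: "cbox a b \<noteq> {}"
    unfolding interval_ne_empty_cart using le by (simp add: less_imp_le)
  have "measure lebesgue (cbox a b) = l ^ CARD('n)"
    using content_cbox_cart[OF ne] assms(2) by simp
  then have c: "emeasure lebesgue (cbox a b) = ennreal (l ^ CARD('n))"
    using emeasure_eq_ennreal_measure[OF fmeasurableD2[OF lmeasurable_cbox[of a b]]] by simp
  moreover have "measure lebesgue (box a b) = measure lebesgue (cbox a b)"
    by (simp add: measure_def emeasure_lborel_box_eq emeasure_lborel_cbox_eq)
  then have "emeasure lebesgue (box a b) = emeasure lebesgue (cbox a b)"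
    using emeasure_eq_ennreal_measure[OF fmeasurableD2[OF lmeasurable_cbox[of a b]]]
      emeasure_eq_ennreal_measure[OF fmeasurableD2[OF lmeasurable_box[of a b]]] by simp
  moreover have "emeasure lebesgue (box a b) \<le> emeasure lebesgue Q"
    using Q by (intro emeasure_mono) (auto simp: Q_def mem_box_cart intro: less_imp_le)
  moreover have "emeasure lebesgue Q \<le> emeasure lebesgue (cbox a b)"
    by (intro emeasure_mono) (auto simp: Q_def mem_box_cart less_imp_le)
  ultimately show "emeasure lebesgue Q = ennreal (l ^ CARD('n))"
    by simp
qed

text \<open>The side of a cube controls both its measure and its distance from any of its points, so that cubes and centred balls
  are comparable.\<close>

lemma cube_side:
  fixes Q :: "(real ^ 'n) set"
  assumes "cube Q" "x \<in> Q"
  obtains l :: real where "0 < l" "Q \<in> sets lebesgue" "emeasure lebesgue Q = ennreal (l ^ CARD('n))"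
    "Q \<subseteq> cball x (CARD('n) * l)"
proof -
  obtain a b where ab: "\<forall>i. a $ i < b $ i" "\<forall>i j. b $ i - a $ i = b $ j - a $ j"
    and Q: "Q = {x. \<forall>i. a $ i \<le> x $ i \<and> x $ i < b $ i}"
    using assms(1) by (auto simp: cube_def)
  obtain l where l: "\<And>i. b $ i - a $ i = l"
    using ab(2) by metis
  have "0 < l"
    using ab(1) l by (metis diff_gt_0_iff_gt)
  moreover have "Q \<subseteq> cball x (CARD('n) * l)"
  proof
    fix y assume "y \<in> Q"
    have "\<bar>(x - y) $ i\<bar> \<le> l" for i
      using \<open>y \<in> Q\<close> \<open>x \<in> Q\<close> l[of i] unfolding Q by (auto simp: abs_le_iff dest!: spec[of _ i])
    then have "norm (x - y) \<le> (\<Sum>i::'n\<in>UNIV. l)"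
      by (intro order_trans[OF norm_le_l1_cart] sum_mono)
    then show "y \<in> cball x (CARD('n) * l)"
      by (simp add: dist_norm)
  qed
  ultimately show ?thesis
    using that[of l] emeasure_half_open_box[OF \<open>0 < l\<close> l] unfolding Q by simp
qed

lemma cube_of_side:
  fixes x :: "real ^ 'n" and l :: real
  assumes "0 < l"
  obtains Q where "cube Q" "x \<in> Q" "Q \<in> sets lebesgue" "emeasure lebesgue Q = ennreal (l ^ CARD('n))"
    "Q \<subseteq> cball x (CARD('n) * l)"
proof -
  define b where "b = x + (\<chi> i. l)"
  define Q where "Q = {y. \<forall>i. x $ i \<le> y $ i \<and> y $ i < b $ i}"
  have b: "b $ i - x $ i = l" for i
    by (simp add: b_def)
  have "cube Q"
    unfolding cube_def Q_def using b assms by (intro exI[of _ x] exI[of _ b]) (auto simp: b_def)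
  moreover have "x \<in> Q"
    using assms by (auto simp: Q_def b_def)
  ultimately obtain l' :: real where l': "0 < l'" "emeasure lebesgue Q = ennreal (l' ^ CARD('n))"
      "Q \<subseteq> cball x (CARD('n) * l')" 
    by (rule cube_side) auto
  have Q: "Q \<in> sets lebesgue" "emeasure lebesgue Q = ennreal (l ^ CARD('n))"
    using emeasure_half_open_box[OF assms b] by (auto simp: Q_def)
  then have "l' = l"
    using l' assms by (simp add: power_eq_iff_eq_base)
  then show ?thesis
    using that \<open>cube Q\<close> \<open>x \<in> Q\<close> Q l' by blast
qed

lemma small_cube:
  fixes x :: "real ^ 'n"
  assumes "0 < \<delta>"
  obtains Q where "cube Q" "x \<in> Q" "emeasure lebesgue Q < ennreal \<delta>"
proof -
  define l where "l = min 1 (\<delta> / 2)"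
  have l: "0 < l" "l \<le> 1" "l < \<delta>"
    using assms by (auto simp: l_def)
  have "l ^ CARD('n) \<le> l ^ 1"
    using l by (intro power_decreasing) (auto simp: Suc_le_eq)
  then have "ennreal (l ^ CARD('n)) < ennreal \<delta>"
    using l by (simp add: ennreal_less_iff)
  moreover obtain Q where "cube Q" "x \<in> Q" "emeasure lebesgue Q = ennreal (l ^ CARD('n))"
    using l(1) by (rule cube_of_side[of l x])
  ultimately show ?thesis
    using that by simp
qed

lemma emeasure_cball_ge:
  fixes x :: "real ^ 'n"
  assumes "0 < r"
  shows "ennreal ((r / CARD('n)) ^ CARD('n)) \<le> emeasure lebesgue (cball x r)"
proof -
  have "0 < r / CARD('n)"
    using assms by simp
  then obtain Q where "emeasure lebesgue Q = ennreal ((r / CARD('n)) ^ CARD('n))" 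
      "Q \<subseteq> cball x (CARD('n) * (r / CARD('n)))"
    by (rule cube_of_side[of _ x])
  then show ?thesis
    using emeasure_mono[of Q "cball x r" lebesgue] by simp
qed

lemma tail_emeasure_tendsto_0:
  fixes A :: "'a::euclidean_space set"
  assumes borel: "sets borel \<subseteq> sets M" and A: "A \<in> sets M" "emeasure M A < \<infinity>"
  shows "(\<lambda>m::nat. emeasure M (A \<inter> - ball 0 (real m - a))) \<longlonglongrightarrow> 0"
proof -
  let ?A = "\<lambda>m::nat. A \<inter> - ball 0 (real m - a)"
  have meas: "?A m \<in> sets M" for m
    using borel A(1) by (auto intro!: sets.Int)
  have "(\<lambda>m. emeasure M (?A m)) \<longlonglongrightarrow> emeasure M (\<Inter>m. ?A m)"
  proof (rule Lim_emeasure_decseq)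
    show "emeasure M (?A m) \<noteq> \<infinity>" for m
      using emeasure_mono[of "?A m" A M] A by (auto simp: top_unique)
    show "decseq ?A"
      by (rule decseq_SucI) auto
  qed (use meas in auto)
  moreover have "(\<Inter>m. ?A m) = {}"
  proof -
    have "x \<notin> ?A (nat \<lceil>norm x + a\<rceil> + 1)" for x :: 'a
      by simp linarith
    then show ?thesis by blast
  qed
  ultimately show ?thesis by simp
qed

lemma dyadic_scale:
  fixes y :: real
  assumes "0 < y" "y \<le> 1"
  obtains j :: nat where "y \<le> (1 / 2) ^ j" "(1 / 2) ^ j < 2 * y"
proof -
  have "\<exists>n. (1 / 2) ^ n < y"
    using assms(1) by (intro real_arch_pow_inv) auto
  then obtain n where n: "(1 / 2) ^ n < y" "\<And>i. i < n \<Longrightarrow> \<not> (1 / 2) ^ i < y"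
    unfolding exists_least_iff[of "\<lambda>n. (1 / 2) ^ n < y"] by blast
  moreover obtain j where "n = Suc j"
    using n(1) assms(2) by (cases n) auto
  ultimately show ?thesis
    using that[of j] by force
qed

section \<open>The fractional energy at a point\<close>

definition fractional_energy :: "real \<Rightarrow> real \<Rightarrow> (real ^ 'n \<Rightarrow> real) \<Rightarrow> real ^ 'n \<Rightarrow> ennreal" where
  "fractional_energy s q u x =
     (\<integral>\<^sup>+ y. ennreal (\<bar>u x - u y\<bar> powr q / norm (x - y) powr (real CARD('n) + s * q)) \<partial>lebesgue)"

lemma borel_measurable_fractional_energy:
  fixes u :: "real ^ 'n \<Rightarrow> real"
  assumes u [measurable]: "u \<in> borel_measurable lebesgue"
  shows "fractional_energy s q u \<in> borel_measurable lebesgue"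
proof -
  interpret sigma_finite_measure "lebesgue :: (real ^ 'n) measure"
    by (rule sigma_finite_lebesgue)
  have [measurable]: "(\<lambda>x::real ^ 'n. x) \<in> borel_measurable lebesgue"
    by (rule measurable_completion) simp
  have "(\<lambda>(x, y). ennreal (\<bar>u x - u y\<bar> powr q / norm (x - y) powr (real CARD('n) + s * q)))
      \<in> borel_measurable (lebesgue \<Otimes>\<^sub>M lebesgue)"
    by measurable
  then show ?thesis
    unfolding fractional_energy_def[abs_def] by (rule borel_measurable_nn_integral)
qed

text \<open>The Chebyshev estimate behind both uses of the energy: a set near \<open>x\<close> on which \<open>u\<close> differs from \<open>u x\<close> by at
  least \<open>\<tau>\<close> is small if the energy at \<open>x\<close> is finite, and forces a large energy if it is large.\<close>

lemma fractional_energy_ge: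
  fixes u :: "real ^ 'n \<Rightarrow> real"
  assumes T: "T \<in> sets lebesgue" "T \<subseteq> cball x \<rho>"
    and \<tau>: "0 < \<tau>" "\<And>y. y \<in> T \<Longrightarrow> \<tau> \<le> \<bar>u x - u y\<bar>"
    and "0 < s" "0 < q"
  shows "ennreal (\<tau> powr q / \<rho> powr (real CARD('n) + s * q)) * emeasure lebesgue T
           \<le> fractional_energy s q u x"
proof -
  have "ennreal (\<tau> powr q / \<rho> powr (real CARD('n) + s * q)) * indicator T y
      \<le> ennreal (\<bar>u x - u y\<bar> powr q / norm (x - y) powr (real CARD('n) + s * q))" for y
  proof (cases "y \<in> T")
    case True
    then have "x \<noteq> y" "norm (x - y) \<le> \<rho>" "\<tau> \<le> \<bar>u x - u y\<bar>"
      using T(2) \<tau> by (force simp: dist_norm)+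
    then have "\<tau> powr q / \<rho> powr (real CARD('n) + s * q)
        \<le> \<bar>u x - u y\<bar> powr q / norm (x - y) powr (real CARD('n) + s * q)"
      using assms by (intro frac_le powr_mono2) auto
    then show ?thesis
      using True by (auto intro: ennreal_leI)
  qed simp
  then have "(\<integral>\<^sup>+ y. ennreal (\<tau> powr q / \<rho> powr (real CARD('n) + s * q)) * indicator T y \<partial>lebesgue)
      \<le> fractional_energy s q u x"
    unfolding fractional_energy_def by (intro nn_integral_mono)
  then show ?thesis
    using T(1) by (simp add: nn_integral_cmult_indicator)
qed

section \<open>Medians and the precise representative\<close>

text \<open>In a cube of side \<open>l\<close> containing \<open>x\<close>, the points where \<open>u\<close> differs from \<open>u x\<close> by at least \<open>\<tau>\<close> have measure at
  most a constant times \<open>l powr (n + s q)\<close>. This is less than half of the measure \<open>l ^ n\<close> of the cube once \<open>l\<close> is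
  small, and then the median of \<open>u\<close> over the cube is within \<open>\<tau>\<close> of \<open>u x\<close>.\<close>

lemma precise_rep_eq_if_fractional_energy_finite:
  fixes u :: "real ^ 'n \<Rightarrow> real"
  assumes u [measurable]: "u \<in> borel_measurable lebesgue"
    and sq: "0 < s" "0 < q" and fin: "fractional_energy s q u x < \<infinity>"
  shows "precise_rep u x = ereal (u x)"
proof -
  let ?N = "CARD('n)"
  have near: "\<exists>\<delta>>0. \<forall>Q. cube Q \<and> x \<in> Q \<and> emeasure lebesgue Q < ennreal \<delta> \<longrightarrow>
      ereal (u x - \<tau>) \<le> median u Q \<and> median u Q \<le> ereal (u x + \<tau>)" if "0 < \<tau>" for \<tau>
  proof -
    define e where "e = enn2real (fractional_energy s q u x)"
    have e: "fractional_energy s q u x = ennreal e" "0 \<le> e"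
      using fin by (auto simp: e_def)
    define K where "K = e * real ?N powr (real ?N + s * q) / \<tau> powr q"
    have K: "0 \<le> K"
      using e by (simp add: K_def)
    \<comment> \<open>chosen such that \<open>K * l powr (s * q) < 1 / 2\<close> for \<open>0 < l < l0\<close>\<close>
    define l0 where "l0 = (1 / (2 * K + 1)) powr (1 / (s * q))"
    have l0: "0 < l0" "l0 powr (s * q) = 1 / (2 * K + 1)"
      using K sq by (auto simp: l0_def powr_powr)
    have "ereal (u x - \<tau>) \<le> median u Q \<and> median u Q \<le> ereal (u x + \<tau>)"
      if Q: "cube Q" "x \<in> Q" "emeasure lebesgue Q < ennreal (l0 ^ ?N)" for Q
    proof -
      obtain l :: real where l: "0 < l" "Q \<in> sets lebesgue" "emeasure lebesgue Q = ennreal (l ^ ?N)"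
          "Q \<subseteq> cball x (?N * l)"
        using Q(1,2) by (rule cube_side)
      have [measurable]: "Q \<in> sets lebesgue" by fact
      have "l ^ ?N < l0 ^ ?N"
        using Q(3) l(1) unfolding l(3) by (simp add: ennreal_less_iff)
      then have "l < l0"
        using l0(1) by (intro power_less_imp_less_base[of l ?N l0]) auto
      then have "K * l powr (s * q) \<le> K * l0 powr (s * q)"
        using l(1) sq K by (intro mult_left_mono powr_mono2) auto
      also have "\<dots> < 1 / 2"
        unfolding l0(2) using K by (simp add: field_simps)
      finally have small: "K * l powr (s * q) < 1 / 2" .
      define T where "T = {y \<in> Q. \<tau> \<le> \<bar>u x - u y\<bar>}"
      have T [measurable]: "T \<in> sets lebesgue"
        unfolding T_def by (rule sets_lebesgue_Collect_in) measurable
      have T_energy: "ennreal (\<tau> powr q / (?N * l) powr (real ?N + s * q)) * emeasure lebesgue T \<le> ennreal e"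
        unfolding e(1)[symmetric] using sq l(4) \<open>0 < \<tau>\<close> T
        by (intro fractional_energy_ge) (auto simp: T_def)
      have T_less: "emeasure lebesgue T < ennreal (l ^ ?N / 2)"
      proof -
        let ?a = "real ?N + s * q"
        have "emeasure lebesgue T \<le> emeasure lebesgue Q"
          by (intro emeasure_mono) (auto simp: T_def)
        then obtain t where t: "emeasure lebesgue T = ennreal t" "0 \<le> t"
          unfolding l(3) by (cases "emeasure lebesgue T") (auto simp: top_unique)
        have "\<tau> powr q / (?N * l) powr ?a * t \<le> e"
          using T_energy e(2) t(2) by (simp add: t(1) ennreal_mult[symmetric])
        then have "t \<le> e * (?N * l) powr ?a / \<tau> powr q"
          using l(1) \<open>0 < \<tau>\<close> by (simp add: field_simps)
        also have "\<dots> = (K * l powr (s * q)) * l ^ ?N"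
          using l(1) by (simp add: K_def powr_mult powr_add powr_realpow)
        also have "\<dots> < 1 / 2 * l ^ ?N"
          using small l(1) by (intro mult_strict_right_mono) auto
        finally show ?thesis
          using t by (simp add: ennreal_less_iff)
      qed
      have lower: "ereal (u x - \<tau>) \<le> median u Q"
      proof -
        have "emeasure lebesgue {y \<in> Q. u y < u x - \<tau>} \<le> emeasure lebesgue T"
          by (intro emeasure_mono) (auto simp: T_def)
        also have "\<dots> \<le> ennreal (l ^ ?N / 2)"
          using T_less by simp
        also have "\<dots> = emeasure lebesgue Q / 2"
          using l by (simp add: ennreal_divide_numeral)
        finally show ?thesis
          unfolding median_def by (intro Sup_upper) auto
      qed
      have "M \<le> u x + \<tau>" if M: "emeasure lebesgue {y \<in> Q. u y < M} \<le> emeasure lebesgue Q / 2" for M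
      proof (rule ccontr)
        assume "\<not> ?thesis"
        then have sub: "Q \<subseteq> T \<union> {y \<in> Q. u y < M}"
          by (auto simp: T_def)
        have "{y \<in> Q. u y < M} \<in> sets lebesgue"
          by (rule sets_lebesgue_Collect_in) measurable
        then have "emeasure lebesgue Q \<le> emeasure lebesgue T + emeasure lebesgue {y \<in> Q. u y < M}"
          using T by (intro order_trans[OF emeasure_mono[OF sub] emeasure_subadditive]) auto
        then have "ennreal (l ^ ?N / 2) < emeasure lebesgue {y \<in> Q. u y < M}"
          using T_less l(1) unfolding l(3) by (intro ennreal_less_of_sum_split) auto
        then show False
          using M l by (simp add: ennreal_divide_numeral leD)
      qed
      then have "median u Q \<le> ereal (u x + \<tau>)"
        unfolding median_def by (auto intro!: Sup_least)
      with lower show ?thesis ..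
    qed
    then show ?thesis
      using l0(1) by (intro exI[of _ "l0 ^ ?N"]) auto
  qed
  show ?thesis
  proof (rule antisym)
    show "precise_rep u x \<le> ereal (u x)"
    proof (rule ereal_le_epsilon2)
      fix \<tau> :: real assume "0 < \<tau>"
      then obtain \<delta> where \<delta>: "0 < \<delta>" "\<And>Q. cube Q \<and> x \<in> Q \<and> emeasure lebesgue Q < ennreal \<delta> \<Longrightarrow>
          median u Q \<le> ereal (u x + \<tau>)"
        using near[OF \<open>0 < \<tau>\<close>] by auto
      have "precise_rep u x \<le> (SUP Q\<in>{Q. cube Q \<and> x \<in> Q \<and> emeasure lebesgue Q < ennreal \<delta>}. median u Q)"
        unfolding precise_rep_def using \<delta>(1) by (intro INF_lower) auto
      also have "\<dots> \<le> ereal (u x + \<tau>)"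
        using \<delta>(2) by (intro SUP_least) auto
      finally show "precise_rep u x \<le> ereal (u x) + ereal \<tau>" by simp
    qed
    show "ereal (u x) \<le> precise_rep u x"
    proof (rule ereal_le_epsilon2)
      fix \<tau> :: real assume "0 < \<tau>"
      then obtain \<delta> where \<delta>: "0 < \<delta>" "\<And>Q. cube Q \<and> x \<in> Q \<and> emeasure lebesgue Q < ennreal \<delta> \<Longrightarrow>
          ereal (u x - \<tau>) \<le> median u Q"
        using near[OF \<open>0 < \<tau>\<close>] by auto
      have "ereal (u x - \<tau>) \<le> precise_rep u x"
        unfolding precise_rep_def
      proof (rule INF_greatest)
        fix \<delta>' :: real assume "\<delta>' \<in> {0<..}"
        then have "0 < min \<delta> \<delta>'"
          using \<delta>(1) by simp
        then obtain Q where "cube Q" "x \<in> Q" "emeasure lebesgue Q < ennreal (min \<delta> \<delta>')"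
          by (rule small_cube[of _ x])
        then have Q: "cube Q" "x \<in> Q" "emeasure lebesgue Q < ennreal \<delta>" "emeasure lebesgue Q < ennreal \<delta>'"
          by (auto elim!: less_le_trans intro!: ennreal_leI)
        have "ereal (u x - \<tau>) \<le> median u Q"
          using Q by (intro \<delta>(2)) simp
        also have "\<dots> \<le> (SUP Q\<in>{Q. cube Q \<and> x \<in> Q \<and> emeasure lebesgue Q < ennreal \<delta>'}. median u Q)"
          using Q by (intro SUP_upper) simp
        finally show "ereal (u x - \<tau>)
          \<le> (SUP Q\<in>{Q. cube Q \<and> x \<in> Q \<and> emeasure lebesgue Q < ennreal \<delta>'}. median u Q)" .
      qed
      then show "ereal (u x) \<le> precise_rep u x + ereal \<tau>"
        by (cases "precise_rep u x") auto
    qed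
  qed
qed

text \<open>If \<open>u\<^sup>* x \<ge> \<epsilon>\<close>, the upper limit yields arbitrarily small cubes with median above \<open>\<epsilon> / 2\<close>; if
  \<open>u\<^sup>* x \<le> - \<epsilon>\<close>, it makes the medians of all sufficiently small cubes less than \<open>- \<epsilon> / 2\<close>. Either way \<open>\<bar>u\<bar> \<ge> \<epsilon> / 2\<close> on half of
  some small cube.\<close>

lemma large_level_set_in_small_cube:
  fixes u :: "real ^ 'n \<Rightarrow> real"
  assumes u [measurable]: "u \<in> borel_measurable lebesgue"
    and \<epsilon>: "0 < \<epsilon>" "ereal \<epsilon> \<le> \<bar>precise_rep u x\<bar>" and "0 < \<delta>"
  obtains Q where "cube Q" "x \<in> Q" "emeasure lebesgue Q < ennreal \<delta>"
    "emeasure lebesgue Q / 2 \<le> emeasure lebesgue {y \<in> Q. \<epsilon> / 2 \<le> \<bar>u y\<bar>}"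
proof -
  let ?small = "\<lambda>\<delta>. {Q. cube Q \<and> x \<in> Q \<and> emeasure lebesgue Q < ennreal \<delta>}"
  have "ereal \<epsilon> \<le> precise_rep u x \<or> precise_rep u x \<le> ereal (- \<epsilon>)"
    using \<epsilon> by (cases "precise_rep u x") (auto simp: abs_real_def split: if_splits)
  then show ?thesis
  proof
    assume "ereal \<epsilon> \<le> precise_rep u x"
    also have "\<dots> \<le> (SUP Q\<in>?small \<delta>. median u Q)"
      unfolding precise_rep_def using \<open>0 < \<delta>\<close> by (intro INF_lower) auto
    finally have "ereal (\<epsilon> / 2) < (SUP Q\<in>?small \<delta>. median u Q)"
      using \<epsilon>(1) by (auto elim!: less_le_trans[rotated])
    then obtain Q where Q: "cube Q" "x \<in> Q" "emeasure lebesgue Q < ennreal \<delta>" "ereal (\<epsilon> / 2) < median u Q"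
      by (auto simp: less_SUP_iff)
    then obtain M where M: "\<epsilon> / 2 < M" "emeasure lebesgue {y \<in> Q. u y < M} \<le> emeasure lebesgue Q / 2"
      by (auto simp: median_def less_Sup_iff)
    obtain l :: real where l: "0 < l" "Q \<in> sets lebesgue" "emeasure lebesgue Q = ennreal (l ^ CARD('n))"
      using Q(1,2) by (rule cube_side)
    let ?S = "{y \<in> Q. \<epsilon> / 2 \<le> \<bar>u y\<bar>}"
    have S: "?S \<in> sets lebesgue"
      by (rule sets_lebesgue_Collect_in[OF l(2)]) measurable
    have S': "{y \<in> Q. u y < M} \<in> sets lebesgue"
      by (rule sets_lebesgue_Collect_in[OF l(2)]) measurable
    have sub: "Q \<subseteq> ?S \<union> {y \<in> Q. u y < M}"
      using M(1) by auto
    have "emeasure lebesgue Q \<le> emeasure lebesgue ?S + emeasure lebesgue {y \<in> Q. u y < M}"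
      using S S' by (intro order_trans[OF emeasure_mono[OF sub] emeasure_subadditive]) auto
    then have "ennreal (l ^ CARD('n) / 2) \<le> emeasure lebesgue ?S"
      using M(2) l(1) ennreal_less_of_sum_split[of "l ^ CARD('n) / 2" "emeasure lebesgue ?S"]
      unfolding l(3) by (force simp: ennreal_divide_numeral)
    then show ?thesis
      using that[of Q] Q l by (simp add: ennreal_divide_numeral)
  next
    assume "precise_rep u x \<le> ereal (- \<epsilon>)"
    also have "\<dots> < ereal (- (\<epsilon> / 2))"
      using \<epsilon>(1) by simp
    finally obtain \<delta>' where \<delta>': "0 < \<delta>'" "(SUP Q\<in>?small \<delta>'. median u Q) < ereal (- (\<epsilon> / 2))"
      unfolding precise_rep_def by (auto simp: INF_less_iff)
    have "0 < min \<delta> \<delta>'"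
      using \<delta>'(1) \<open>0 < \<delta>\<close> by simp
    then obtain Q where "cube Q" "x \<in> Q" "emeasure lebesgue Q < ennreal (min \<delta> \<delta>')"
      by (rule small_cube[of _ x])
    then have Q: "cube Q" "x \<in> Q" "emeasure lebesgue Q < ennreal \<delta>" "emeasure lebesgue Q < ennreal \<delta>'"
      by (auto elim!: less_le_trans intro!: ennreal_leI)
    obtain l :: real where "Q \<in> sets lebesgue" "emeasure lebesgue Q = ennreal (l ^ CARD('n))"
      using Q(1,2) by (rule cube_side)
    have "median u Q \<le> (SUP Q\<in>?small \<delta>'. median u Q)"
      using Q by (intro SUP_upper) simp
    then have less: "median u Q < ereal (- (\<epsilon> / 2))"
      using \<delta>'(2) by (rule le_less_trans)
    have "\<not> emeasure lebesgue {y \<in> Q. u y < - (\<epsilon> / 2)} \<le> emeasure lebesgue Q / 2"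
    proof
      assume "emeasure lebesgue {y \<in> Q. u y < - (\<epsilon> / 2)} \<le> emeasure lebesgue Q / 2"
      then have "ereal (- (\<epsilon> / 2)) \<le> median u Q"
        unfolding median_def by (intro Sup_upper) auto
      with less show False by simp
    qed
    then have "emeasure lebesgue Q / 2 \<le> emeasure lebesgue {y \<in> Q. u y < - (\<epsilon> / 2)}"
      by simp
    also have "\<dots> \<le> emeasure lebesgue {y \<in> Q. \<epsilon> / 2 \<le> \<bar>u y\<bar>}"
    proof (rule emeasure_mono)
      show "{y \<in> Q. \<epsilon> / 2 \<le> \<bar>u y\<bar>} \<in> sets lebesgue"
        by (rule sets_lebesgue_Collect_in[OF \<open>Q \<in> sets lebesgue\<close>]) measurable
    qed auto
    finally show ?thesis
      using that Q by blast
  qed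
qed

section \<open>Energy in a stopping ball\<close>

text \<open>The exponent \<open>d\<close> measures how far \<open>L\<close> exceeds the critical exponent \<open>n - s p\<close>. It has to be positive for the
  thresholds \<open>t r\<close> to stay bounded, and it enters the energy bound through the increments of \<open>t\<close>. The fraction
  \<open>\<theta>\<close> is small enough for two purposes: half of the measure of a cube of side \<open>l\<close> is at least \<open>\<theta> r ^ n\<close> if
  \<open>r < 2 n l\<close>, which the choice of a dyadic radius \<open>r \<ge> n l\<close> permits, and every ball of radius \<open>r\<close> has measure
  at least \<open>2 \<theta> r ^ n\<close>.\<close>

lemma stopping_ball_energy:
  fixes u :: "real ^ 'n \<Rightarrow> real"
  assumes u [measurable]: "u \<in> borel_measurable lebesgue"
    and spq: "0 < s" "0 < p" "0 < q" and \<epsilon>: "0 < \<epsilon>" and L: "real CARD('n) - s * p < L"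
  obtains c \<theta> where "0 < c" "0 < \<theta>"
    "\<And>x. \<lbrakk>ereal \<epsilon> \<le> \<bar>precise_rep u x\<bar>;
           emeasure lebesgue {y \<in> cball x 1. \<epsilon> / 4 < \<bar>u y\<bar>} < ennreal \<theta>\<rbrakk> \<Longrightarrow>
       \<exists>r. 0 < r \<and> r \<le> 1 \<and> ennreal (c * r powr L)
         \<le> (\<integral>\<^sup>+ z. ennreal_powr (fractional_energy s q u z) (p / q) * indicator (cball x r) z \<partial>lebesgue)"
proof -
  let ?N = "CARD('n)"
  define a where "a = real ?N + s * q"
  define d where "d = (L - real ?N) / p + s"
  have "0 < d"
    using L spq by (simp add: d_def field_simps)
  have d_p: "(d - s) * p + real ?N = L"
    using spq by (simp add: d_def)
  define \<theta> where "\<theta> = 1 / (2 * (2 * real ?N) ^ ?N)"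
  have "0 < \<theta>" by (simp add: \<theta>_def)
  define \<kappa> where "\<kappa> = \<epsilon> / 4 * (2 powr d - 1)"
  have "1 < (2::real) powr d"
    using \<open>0 < d\<close> by simp
  then have "0 < \<kappa>"
    using \<epsilon> by (simp add: \<kappa>_def)
  define K where "K = \<kappa> powr q * \<theta> / 4 powr a"
  have "0 < K"
    using \<open>0 < \<kappa>\<close> \<open>0 < \<theta>\<close> by (simp add: K_def)
  define c where "c = K powr (p / q) * \<theta>"
  have "0 < c"
    using \<open>0 < K\<close> \<open>0 < \<theta>\<close> by (simp add: c_def)
  \<comment> \<open>\<open>t 1 = \<epsilon> / 4\<close> is the level at unit scale\<close>
  define t where "t r = \<epsilon> / 4 + \<epsilon> / 4 * (1 - r powr d)" for r :: real
  have t_step: "t r - t (2 * r) = \<kappa> * r powr d" if "0 < r" for r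
    using that by (simp add: t_def \<kappa>_def powr_mult field_simps)
  have t_less: "t r < \<epsilon> / 2" if "0 < r" for r
  proof -
    have "t r = \<epsilon> / 2 - \<epsilon> / 4 * r powr d"
      unfolding t_def right_diff_distrib by linarith
    moreover have "0 < \<epsilon> / 4 * r powr d"
      using that \<epsilon> by simp
    ultimately show ?thesis by linarith
  qed
  have "\<exists>r. 0 < r \<and> r \<le> 1 \<and> ennreal (c * r powr L)
         \<le> (\<integral>\<^sup>+ z. ennreal_powr (fractional_energy s q u z) (p / q) * indicator (cball x r) z \<partial>lebesgue)"
    if large: "ereal \<epsilon> \<le> \<bar>precise_rep u x\<bar>"
      and unit_ball: "emeasure lebesgue {y \<in> cball x 1. \<epsilon> / 4 < \<bar>u y\<bar>} < ennreal \<theta>" for x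
  proof -
    define dense where "dense r \<longleftrightarrow> ennreal (\<theta> * r ^ ?N) \<le> emeasure lebesgue {y \<in> cball x r. t r < \<bar>u y\<bar>}" for r
    have meas_gt: "{y \<in> cball x r. b < \<bar>u y\<bar>} \<in> sets lebesgue" for r b
      by (rule sets_lebesgue_Collect_in) (simp, measurable)
    have meas_le: "{y \<in> cball x r. \<bar>u y\<bar> \<le> b} \<in> sets lebesgue" for r b
      by (rule sets_lebesgue_Collect_in) (simp, measurable)
    have "\<exists>j::nat. dense ((1 / 2) ^ j)"
    proof -
      \<comment> \<open>a cube of side less than \<open>1 / n\<close> around \<open>x\<close> lies in the unit ball, hence in a ball of dyadic radius at most \<open>1\<close> that is comparable to its side\<close>
      have "0 < (1 / real ?N) ^ ?N" by simp
      then obtain Q where Q: "cube Q" "x \<in> Q" "emeasure lebesgue Q < ennreal ((1 / real ?N) ^ ?N)"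
          "emeasure lebesgue Q / 2 \<le> emeasure lebesgue {y \<in> Q. \<epsilon> / 2 \<le> \<bar>u y\<bar>}"
        by (rule large_level_set_in_small_cube[OF u \<epsilon> large])
      obtain l :: real where l: "0 < l" "Q \<in> sets lebesgue" "emeasure lebesgue Q = ennreal (l ^ ?N)"
          "Q \<subseteq> cball x (?N * l)"
        using Q(1,2) by (rule cube_side)
      have "l ^ ?N < (1 / real ?N) ^ ?N"
        using Q(3) l(1) unfolding l(3) by (simp add: ennreal_less_iff)
      then have "l < 1 / real ?N"
        by (intro power_less_imp_less_base[of l ?N "1 / real ?N"]) auto
      then have Nl: "0 < ?N * l" "?N * l \<le> 1"
        using l(1) by (auto simp: field_simps)
      obtain j :: nat where j: "?N * l \<le> (1 / 2) ^ j" "(1 / 2) ^ j < 2 * (?N * l)"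
        using Nl by (rule dyadic_scale)
      let ?r = "(1 / 2 :: real) ^ j"
      have "(?r / (2 * ?N)) ^ ?N \<le> l ^ ?N"
        using j by (intro power_mono) (auto simp: field_simps)
      then have "\<theta> * ?r ^ ?N \<le> l ^ ?N / 2"
        by (simp add: \<theta>_def power_divide power_mult_distrib mult_ac)
      then have "ennreal (\<theta> * ?r ^ ?N) \<le> emeasure lebesgue Q / 2"
        using l(1) by (simp add: l(3) ennreal_divide_numeral ennreal_leI)
      also have "\<dots> \<le> emeasure lebesgue {y \<in> Q. \<epsilon> / 2 \<le> \<bar>u y\<bar>}"
        by fact
      also have "\<dots> \<le> emeasure lebesgue {y \<in> cball x ?r. t ?r < \<bar>u y\<bar>}"
      proof (rule emeasure_mono[OF _ meas_gt])
        have "cball x (?N * l) \<subseteq> cball x ?r"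
          using j(1) by (rule subset_cball)
        then show "{y \<in> Q. \<epsilon> / 2 \<le> \<bar>u y\<bar>} \<subseteq> {y \<in> cball x ?r. t ?r < \<bar>u y\<bar>}"
          using l(4) t_less[of ?r] by fastforce
      qed
      finally show ?thesis
        unfolding dense_def by blast
    qed
    then obtain j where j: "dense ((1 / 2) ^ j)" and least: "\<And>i. i < j \<Longrightarrow> \<not> dense ((1 / 2) ^ i)"
      unfolding exists_least_iff[of "\<lambda>j. dense ((1 / 2) ^ j)"] by blast
    \<comment> \<open>the stopping radius is not the initial one, hence its double is a dyadic radius to which minimality applies\<close>
    have "\<not> dense 1"
      using unit_ball by (simp add: dense_def t_def)
    then have "j \<noteq> 0"
      using j by (intro notI) simp
    then obtain i where i: "j = Suc i"
      by (cases j) auto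
    define r :: real where "r = (1 / 2) ^ j"
    have r: "0 < r" "r \<le> 1" "2 * r = (1 / 2) ^ i"
      by (simp_all add: r_def power_le_one) (simp add: i)
    \<comment> \<open>the two sets between which \<open>u\<close> jumps\<close>
    define S where "S = {y \<in> cball x r. t r < \<bar>u y\<bar>}"
    define T where "T = {y \<in> cball x (2 * r). \<bar>u y\<bar> \<le> t (2 * r)}"
    have S: "S \<in> sets lebesgue" and T: "T \<in> sets lebesgue"
      unfolding S_def T_def by (rule meas_gt meas_le)+
    have S_ge: "ennreal (\<theta> * r ^ ?N) \<le> emeasure lebesgue S"
      using j by (simp add: dense_def S_def r_def)
    have T_ge: "ennreal (\<theta> * r ^ ?N) \<le> emeasure lebesgue T"
    proof -
      let ?U = "{y \<in> cball x (2 * r). t (2 * r) < \<bar>u y\<bar>}"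
      have U: "?U \<in> sets lebesgue"
        by (rule meas_gt)
      have "2 * (\<theta> * (2 * r) ^ ?N) \<le> (2 * r / ?N) ^ ?N"
        using r(1) by (simp add: \<theta>_def field_simps)
      then have "ennreal (2 * (\<theta> * (2 * r) ^ ?N)) \<le> ennreal ((2 * r / ?N) ^ ?N)"
        by (rule ennreal_leI)
      also have "\<dots> \<le> emeasure lebesgue (cball x (2 * r))"
        using r(1) by (intro emeasure_cball_ge) simp
      also have "\<dots> \<le> emeasure lebesgue (?U \<union> T)"
        using sets.Un[OF U T] by (rule emeasure_mono[rotated]) (auto simp: T_def)
      also have "\<dots> \<le> emeasure lebesgue ?U + emeasure lebesgue T"
        by (rule emeasure_subadditive[OF U T])
      finally have "ennreal (\<theta> * (2 * r) ^ ?N) < emeasure lebesgue T"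
      proof (rule ennreal_less_of_sum_split)
        show "0 \<le> \<theta> * (2 * r) ^ ?N"
          using \<open>0 < \<theta>\<close> r(1) by simp
        have "\<not> dense (2 * r)"
          unfolding r(3) by (rule least) (simp add: i)
        then show "emeasure lebesgue ?U < ennreal (\<theta> * (2 * r) ^ ?N)"
          unfolding dense_def by (rule not_le_imp_less)
      qed
      moreover have "\<theta> * r ^ ?N \<le> \<theta> * (2 * r) ^ ?N"
        using \<open>0 < \<theta>\<close> r(1) by (intro mult_left_mono power_mono) auto
      ultimately show ?thesis
        by (meson ennreal_leI less_imp_le order_trans)
    qed
    have energy: "ennreal (K powr (p / q) * r powr ((d - s) * p)) \<le> ennreal_powr (fractional_energy s q u z) (p / q)"
      if "z \<in> S" for z
    proof -
      have z: "dist x z \<le> r" "t r < \<bar>u z\<bar>"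
        using that by (auto simp: S_def)
      have "(\<kappa> * r powr d) powr q / (4 * r) powr a * (\<theta> * r ^ ?N) = K * r powr ((d - s) * q)"
        using r(1) \<open>0 < \<kappa>\<close>
        by (simp add: K_def a_def powr_mult powr_powr powr_add powr_diff right_diff_distrib powr_realpow mult_ac)
      then have "ennreal (K * r powr ((d - s) * q))
          = ennreal ((\<kappa> * r powr d) powr q / (4 * r) powr a) * ennreal (\<theta> * r ^ ?N)"
        using r(1) \<open>0 < \<theta>\<close> by (simp add: ennreal_mult[symmetric])
      also have "\<dots> \<le> ennreal ((\<kappa> * r powr d) powr q / (4 * r) powr a) * emeasure lebesgue T"
        using T_ge by (intro mult_left_mono) auto
      also have "\<dots> \<le> fractional_energy s q u z"
        unfolding a_def
      proof (rule fractional_energy_ge[OF T])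
        \<comment> \<open>distance at most \<open>r + 2 r\<close> via the centre \<open>x\<close>\<close>
        show "T \<subseteq> cball z (4 * r)"
        proof
          fix y assume "y \<in> T"
          then have "dist x y \<le> 2 * r" by (simp add: T_def)
          then show "y \<in> cball z (4 * r)"
            using z(1) r(1) dist_triangle3[of z y x] by simp
        qed
        show "0 < \<kappa> * r powr d"
          using \<open>0 < \<kappa>\<close> r(1) by simp
        show "\<kappa> * r powr d \<le> \<bar>u z - u y\<bar>" if "y \<in> T" for y
        proof -
          have "\<bar>u y\<bar> \<le> t (2 * r)"
            using that by (simp add: T_def)
          then show ?thesis
            using z(2) t_step[OF r(1)] by linarith
        qed
      qed (use spq in auto)
      finally have "ennreal_powr (ennreal (K * r powr ((d - s) * q))) (p / q)
          \<le> ennreal_powr (fractional_energy s q u z) (p / q)"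
        using spq by (intro ennreal_powr_mono) auto
      then show ?thesis
        using \<open>0 < K\<close> spq by (simp add: ennreal_powr_ennreal powr_mult powr_powr)
    qed
    have "c * r powr L = (K powr (p / q) * r powr ((d - s) * p)) * (\<theta> * r ^ ?N)"
      unfolding d_p[symmetric] using r(1) by (simp add: c_def powr_add powr_realpow)
    then have "ennreal (c * r powr L) = ennreal (K powr (p / q) * r powr ((d - s) * p)) * ennreal (\<theta> * r ^ ?N)"
      using \<open>0 < \<theta>\<close> r(1) by (simp add: ennreal_mult[symmetric])
    also have "\<dots> \<le> ennreal (K powr (p / q) * r powr ((d - s) * p)) * emeasure lebesgue S"
      using S_ge by (intro mult_left_mono) auto
    also have "\<dots> = (\<integral>\<^sup>+ z. ennreal (K powr (p / q) * r powr ((d - s) * p)) * indicator S z \<partial>lebesgue)"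
      using S by (simp add: nn_integral_cmult_indicator)
    also have "\<dots> \<le> (\<integral>\<^sup>+ z. ennreal_powr (fractional_energy s q u z) (p / q) * indicator (cball x r) z \<partial>lebesgue)"
      using energy by (intro nn_integral_mono) (auto simp: S_def split: split_indicator)
    finally show ?thesis
      using r by blast
  qed
  then show ?thesis
    using that[OF \<open>0 < c\<close> \<open>0 < \<theta>\<close>] by blast
qed

section \<open>Level sets near infinity\<close>

text \<open>Since \<open>u = u\<^sup>*\<close> almost everywhere, \<open>{\<bar>u\<bar> > \<epsilon> / 4}\<close> has finite measure, so unit balls far out meet it in a set of
  small measure and every far point of the level set has a stopping ball. These balls lie in the complement of a
  large ball, where the integrable function \<open>g\<close> has small integral.\<close>

lemma level_set_content_tendsto_0:
  fixes u :: "real ^ 'n \<Rightarrow> real"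
  assumes u [measurable]: "u \<in> borel_measurable lebesgue"
    and spq: "0 < s" "0 < p" "0 < q"
    and seminorm: "sobolev_seminorm s p q u < \<infinity>" and Lp: "precise_rep u \<in> Lp_functions p"
    and \<epsilon>: "0 < \<epsilon>" and L: "0 < L" "real CARD('n) - s * p < L"
  shows "(\<lambda>m::nat. hausdorff_content L ({x. ereal \<epsilon> \<le> \<bar>precise_rep u x\<bar>} \<inter> - ball 0 (real m))) \<longlonglongrightarrow> 0"
proof -
  let ?A = "{x. ereal \<epsilon> \<le> \<bar>precise_rep u x\<bar>}"
  define g where "g z = ennreal_powr (fractional_energy s q u z) (p / q)" for z
  have [measurable]: "fractional_energy s q u \<in> borel_measurable lebesgue"
    by (rule borel_measurable_fractional_energy[OF u])
  have g_meas [measurable]: "g \<in> borel_measurable lebesgue"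
    unfolding g_def[abs_def] ennreal_powr_def by measurable
  have g_fin: "(\<integral>\<^sup>+ z. g z \<partial>lebesgue) < \<infinity>"
    using seminorm unfolding sobolev_seminorm_def ennreal_powr_less_top_iff g_def fractional_energy_def .
  have rep: "AE x in lebesgue. precise_rep u x = ereal (u x)"
  proof -
    have "AE x in lebesgue. g x \<noteq> \<infinity>"
      using g_fin by (intro nn_integral_noteq_infinite) auto
    then show ?thesis
    proof eventually_elim
      case (elim x)
      then have "fractional_energy s q u x < \<infinity>"
        by (auto simp: g_def ennreal_powr_def less_top[symmetric])
      then show ?case
        using precise_rep_eq_if_fractional_energy_finite[OF u] spq by blast
    qed
  qed
  define H where "H = {y. \<epsilon> / 4 < \<bar>u y\<bar>}"
  have H: "H \<in> sets lebesgue"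
    using sets_lebesgue_Collect_in[of UNIV "\<lambda>y. \<epsilon> / 4 < \<bar>u y\<bar>"] by (simp add: H_def)
  have H_fin: "emeasure lebesgue H < \<infinity>"
  proof -
    have "ennreal ((\<epsilon> / 4) powr p) * emeasure lebesgue H
        = (\<integral>\<^sup>+ x. ennreal ((\<epsilon> / 4) powr p) * indicator H x \<partial>lebesgue)"
      using H by (simp add: nn_integral_cmult_indicator)
    also have "\<dots> \<le> (\<integral>\<^sup>+ x. ennreal_powr (e2ennreal \<bar>precise_rep u x\<bar>) p \<partial>lebesgue)"
    proof (rule nn_integral_mono_AE, use rep in eventually_elim)
      case (elim x)
      have "(\<epsilon> / 4) powr p \<le> \<bar>u x\<bar> powr p" if "x \<in> H"
        using that \<epsilon> spq by (intro powr_mono2) (auto simp: H_def)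
      then show ?case
        unfolding elim by (auto simp: ennreal_powr_ennreal e2ennreal_ereal split: split_indicator)
    qed
    also have "\<dots> < \<infinity>"
      using Lp by (simp add: Lp_functions_def)
    finally show ?thesis
      using \<epsilon> by (auto simp: ennreal_mult_less_top)
  qed
  obtain c \<theta> where c: "0 < c" "0 < \<theta>" and stop:
    "\<And>x. \<lbrakk>ereal \<epsilon> \<le> \<bar>precise_rep u x\<bar>;
           emeasure lebesgue {y \<in> cball x 1. \<epsilon> / 4 < \<bar>u y\<bar>} < ennreal \<theta>\<rbrakk> \<Longrightarrow>
       \<exists>r. 0 < r \<and> r \<le> 1 \<and> ennreal (c * r powr L)
         \<le> (\<integral>\<^sup>+ z. g z * indicator (cball x r) z \<partial>lebesgue)"
    unfolding g_def by (rule stopping_ball_energy[OF u spq \<epsilon> L(2)]) blast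
  define \<mu> where "\<mu> = density lebesgue g"
  have \<mu>_sets: "sets \<mu> = sets lebesgue" by (simp add: \<mu>_def)
  have \<mu>_tail: "(\<lambda>m::nat. emeasure \<mu> (UNIV \<inter> - ball 0 (real m - 1))) \<longlonglongrightarrow> 0"
    using g_fin borel_sets_lebesgue by (intro tail_emeasure_tendsto_0) (simp_all add: \<mu>_def emeasure_density)
  have H_tail: "(\<lambda>m::nat. emeasure lebesgue (H \<inter> - ball 0 (real m - 1))) \<longlonglongrightarrow> 0"
    using borel_sets_lebesgue H H_fin by (rule tail_emeasure_tendsto_0)
  have sub: "cball x r \<subseteq> - ball 0 (real m - 1)" if "x \<in> - ball 0 (real m)" "r \<le> 1" for x :: "real^'n" and r m
  proof
    fix y assume "y \<in> cball x r"
    then show "y \<in> - ball 0 (real m - 1)"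
      using that norm_triangle_sub[of x y] by (simp add: dist_norm)
  qed
  have "\<forall>\<^sub>F m::nat in sequentially. emeasure lebesgue (H \<inter> - ball 0 (real m - 1)) < ennreal \<theta>"
    using H_tail c(2) by (intro order_tendstoD(2)) auto
  then have bound: "\<forall>\<^sub>F m::nat in sequentially. hausdorff_content L (?A \<inter> - ball 0 (real m))
      \<le> ennreal (10 powr L / c) * emeasure \<mu> (UNIV \<inter> - ball 0 (real m - 1))"
  proof eventually_elim
    case (elim m)
    show ?case
    proof (rule hausdorff_content_le_measure)
      fix x assume x: "x \<in> ?A \<inter> - ball 0 (real m)"
      have "{y \<in> cball x 1. \<epsilon> / 4 < \<bar>u y\<bar>} \<subseteq> H \<inter> - ball 0 (real m - 1)"
        using sub[of x m 1] x by (auto simp: H_def)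
      then have "emeasure lebesgue {y \<in> cball x 1. \<epsilon> / 4 < \<bar>u y\<bar>} \<le> emeasure lebesgue (H \<inter> - ball 0 (real m - 1))"
        using H by (intro emeasure_mono) auto
      also note elim
      finally obtain r where r: "0 < r" "r \<le> 1"
        "ennreal (c * r powr L) \<le> (\<integral>\<^sup>+ z. g z * indicator (cball x r) z \<partial>lebesgue)"
        using stop[of x] x by auto
      then show "\<exists>r. 0 < r \<and> r \<le> 1 \<and> cball x r \<subseteq> UNIV \<inter> - ball 0 (real m - 1) \<and>
          ennreal (c * r powr L) \<le> emeasure \<mu> (cball x r)"
        using sub[of x m r] x by (intro exI[of _ r]) (auto simp: \<mu>_def emeasure_density)
    next
      show "sets borel \<subseteq> sets \<mu>"
        unfolding \<mu>_sets by (rule borel_sets_lebesgue)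
      show "UNIV \<inter> - ball 0 (real m - 1) \<in> sets \<mu>"
        unfolding \<mu>_sets by simp
    qed (rule c(1) L(1))+
  qed
  have "(\<lambda>m::nat. ennreal (10 powr L / c) * emeasure \<mu> (UNIV \<inter> - ball 0 (real m - 1)))
      \<longlonglongrightarrow> ennreal (10 powr L / c) * 0"
    using \<mu>_tail by (intro tendsto_mult_ennreal) auto
  then show ?thesis
    by (intro tendsto_sandwich[OF _ bound tendsto_const]) auto
qed

theorem corollary1p5:
  fixes s p q :: real and ustar :: "real ^ 'n \<Rightarrow> ereal"
  assumes "CARD('n) \<ge> 2" and "0 < s" and "s < 1" and "0 < p" and "0 < q"
    and "ustar \<in> sobolev s p q"
  shows "\<exists>E. thin_at_infinity p s E \<and>
           (\<forall>\<epsilon>::real>0. \<exists>R::real>0. \<forall>x. x \<notin> E \<longrightarrow> norm x > R \<longrightarrow> \<bar>ustar x\<bar> < ereal \<epsilon>)"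
proof -
  obtain u where u: "u \<in> borel_measurable lebesgue" "sobolev_seminorm s p q u < \<infinity>"
    and ustar: "ustar = precise_rep u" "precise_rep u \<in> Lp_functions p"
    using assms(6) by (auto simp: sobolev_def homogeneous_sobolev_def)
  define A where "A k = {x. ereal (1 / real (Suc k)) \<le> \<bar>ustar x\<bar>}" for k
  have "(\<lambda>m::nat. hausdorff_content l (A k \<inter> - ball 0 (real m))) \<longlonglongrightarrow> 0"
    if "0 < l" "real CARD('n) - s * p < l" for k l
    unfolding A_def ustar(1)
    by (rule level_set_content_tendsto_0[OF u(1) assms(2,4,5) u(2) ustar(2) _ that]) simp
  then obtain E where thin: "\<forall>l>0. real CARD('n) - s * p < l \<longrightarrow>
        (\<lambda>m::nat. hausdorff_content l (E \<inter> - ball 0 (real m))) \<longlonglongrightarrow> 0"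
    and E: "\<And>k. \<exists>m::nat. A k \<inter> - ball 0 (real m) \<subseteq> E"
    using diagonal_thin_set[of "real CARD('n) - s * p" A] by blast
  have "\<exists>R::real>0. \<forall>x. x \<notin> E \<longrightarrow> norm x > R \<longrightarrow> \<bar>ustar x\<bar> < ereal \<epsilon>" if "0 < \<epsilon>" for \<epsilon> :: real
  proof -
    obtain k where k: "1 / real (Suc k) < \<epsilon>"
      using \<open>0 < \<epsilon>\<close> by (rule nat_approx_posE)
    obtain m :: nat where m: "A k \<inter> - ball 0 (real m) \<subseteq> E"
      using E by blast
    have "\<bar>ustar x\<bar> < ereal \<epsilon>" if "x \<notin> E" "norm x > real m + 1" for x
    proof -
      have "x \<notin> A k"
        using that m by auto
      then have "\<bar>ustar x\<bar> < ereal (1 / real (Suc k))"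
        by (simp add: A_def)
      also have "\<dots> < ereal \<epsilon>"
        using k by simp
      finally show ?thesis .
    qed
    then show ?thesis
      by (intro exI[of _ "real m + 1"]) auto
  qed
  then show ?thesis
    using thin unfolding thin_at_infinity_def by blast
qed

end
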